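(* Every cellularly embedded graph (ceg) has a subdivision that is the closure of an e-peg.
   Context: Graphs are finite and loopless (multiple edges allowed). A ceg is a graph embedded in a closed oriented surface such that each component of the complement is an open disc. A subdivision of a ceg is obtained by inserting finitely many new vertices of degree $2$ in the interiors of edges, keeping the surface. An e-graph of size $m$ is a graph with $m$ edges labeled bijectively by $[m]$. Its properly embedded graph (peg) $P(\Gamma')$ is constructed as follows: for each vertex $v$ of the e-graph $\Gamma'$ with incident edges $e_1<\dots<e_d$ (ordered by label) take an oriented disc thickening the star of $v$, modeled on a neighborhood in the closed upper half plane with $v$ at the origin on the boundary line, the half-edges drawn from $v$ into the upper half plane with $e_1,\dots,e_d$ in counterclockwise order starting from the right, each half-edge thickened to a ribbon with a free end; then, for each edge, glue the free ends of the ribbons of its two half-edges by an orientation-reversing homeomorphism of intervals (matching the half-edges). This gives a compact oriented surface $F$ with boundary, with $\Gamma'$ embedded in it and all vertices on $\partial F$. An e-peg is a peg of the form $P(\Gamma')$ for some e-graph $\Gamma'$. The closure of $P(\Gamma')$ is the ceg obtained by attaching a disc along each boundary component of $F$; equivalently, it is the ceg whose rotation system (cyclic counterclockwise order of edges at each vertex) is obtained by completing to a cyclic order the linear order by labels of the edges at each vertex. Cegs are considered up to orientation-preserving homeomorphisms that restrict to graph isomorphisms. *)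

theory Defs
  imports "HOL-Complex_Analysis.Complex_Analysis"
begin

section \<open>Closed oriented surfaces\<close>

text \<open>A homeomorphism between open subsets of the plane preserves orientation iff it maps every
  small counterclockwise circle around a point to a loop winding once counterclockwise around the
  image of the point (local degree 1).\<close>

definition orientation_preserving_on :: "complex set \<Rightarrow> (complex \<Rightarrow> complex) \<Rightarrow> bool" where
  "orientation_preserving_on S f \<longleftrightarrow>
     (\<forall>z\<in>S. \<forall>r>0. cball z r \<subseteq> S \<longrightarrow> winding_number (f \<circ> circlepath z r) (f z) = 1)"

definition planar_chart :: "'a topology \<Rightarrow> 'a set \<Rightarrow> ('a \<Rightarrow> complex) \<Rightarrow> bool" where
  "planar_chart X U \<phi> \<longleftrightarrow>
     openin X U \<and> open (\<phi> ` U) \<and>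
     homeomorphic_map (subtopology X U) (top_of_set (\<phi> ` U)) \<phi>"

text \<open>The orientation is given by an atlas (not required to be maximal) of charts, thought of as the
  positively oriented ones. Surfaces need not be connected, as graphs need not be.\<close>

definition closed_oriented_surface :: "'a topology \<Rightarrow> ('a set \<times> ('a \<Rightarrow> complex)) set \<Rightarrow> bool" where
  "closed_oriented_surface X A \<longleftrightarrow>
     compact_space X \<and> Hausdorff_space X \<and>
     (\<forall>(U, \<phi>)\<in>A. planar_chart X U \<phi>) \<and>
     topspace X = (\<Union>(U, \<phi>)\<in>A. U) \<and>
     (\<forall>(U, \<phi>)\<in>A. \<forall>(W, \<psi>)\<in>A.
        orientation_preserving_on (\<phi> ` (U \<inter> W)) (\<psi> \<circ> inv_into U \<phi>))"

section \<open>Cellularly embedded graphs\<close>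

record 'a embedded_graph =
  surface :: "'a topology"
  atlas :: "('a set \<times> ('a \<Rightarrow> complex)) set"
  verts :: "'a set"
  edges :: "'a set set"

text \<open>\<open>is_arc_param X e g\<close>: \<open>g\<close> parametrizes the closed arc \<open>e\<close> homeomorphically.\<close>

definition is_arc_param :: "'a topology \<Rightarrow> 'a set \<Rightarrow> (real \<Rightarrow> 'a) \<Rightarrow> bool" where
  "is_arc_param X e g \<longleftrightarrow> embedding_map (top_of_set {0..1}) X g \<and> g ` {0..1} = e"

text \<open>An edge is a closed arc meeting the vertex set exactly in its two endpoints, which are distinct
  since \<open>g\<close> is injective (no loops). Several edges may have the same endpoints. The components of the
  complement are the faces.\<close>

definition ceg :: "'a embedded_graph \<Rightarrow> bool" where
  "ceg C \<longleftrightarrow>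
     closed_oriented_surface (surface C) (atlas C) \<and>
     finite (verts C) \<and> verts C \<subseteq> topspace (surface C) \<and>
     finite (edges C) \<and>
     (\<forall>e\<in>edges C. \<exists>g. is_arc_param (surface C) e g \<and> e \<inter> verts C = {g 0, g 1}) \<and>
     (\<forall>e\<in>edges C. \<forall>f\<in>edges C. e \<noteq> f \<longrightarrow> e \<inter> f \<subseteq> verts C) \<and>
     (\<forall>D\<in>connected_components_of
            (subtopology (surface C) (topspace (surface C) - (verts C \<union> \<Union>(edges C)))).
        subtopology (surface C) D homeomorphic_space top_of_set (ball (0::complex) 1))"

text \<open>Subdividing keeps the surface and the underlying point set of the graph and adds vertices on
  the edges. For cegs this forces the edges of \<open>C'\<close> to be the arcs into which the new vertices cut
  the edges of \<open>C\<close>, so that every new vertex has degree 2.\<close>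

definition subdivision_of :: "'a embedded_graph \<Rightarrow> 'a embedded_graph \<Rightarrow> bool" where
  "subdivision_of C' C \<longleftrightarrow>
     ceg C' \<and> surface C' = surface C \<and> atlas C' = atlas C \<and>
     verts C \<subseteq> verts C' \<and> verts C' - verts C \<subseteq> \<Union>(edges C) \<and>
     \<Union>(edges C') = \<Union>(edges C)"

section \<open>Rotation systems\<close>

text \<open>\<open>ccw_order C v es\<close>: the list \<open>es\<close> enumerates the edges at \<open>v\<close> in their counterclockwise cyclic
  order (so it is determined only up to rotation of the list). In a positively oriented chart, follow
  each edge from \<open>v\<close> until it first meets a circle around \<open>v\<close>; these initial segments (the arcs \<open>g\<close>)
  are pairwise disjoint away from \<open>v\<close>, and the cyclic order of their end points on the circle is
  the order of the edges around \<open>v\<close>. It does not depend on the chart or the radius, by the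
  Schoenflies theorem. No tameness of the embedding is assumed.\<close>

definition ccw_order :: "'a embedded_graph \<Rightarrow> 'a \<Rightarrow> 'a set list \<Rightarrow> bool" where
  "ccw_order C v es \<longleftrightarrow>
     distinct es \<and> set es = {e \<in> edges C. v \<in> e} \<and>
     (\<exists>(U, \<phi>)\<in>atlas C. \<exists>r>0. \<exists>\<theta> :: nat \<Rightarrow> real.
        v \<in> U \<and> cball (\<phi> v) r \<subseteq> \<phi> ` U \<and>
        (\<forall>i<length es. \<exists>g :: real \<Rightarrow> 'a. embedding_map (top_of_set {0..1}) (surface C) g \<and>
           g 0 = v \<and> g ` {0..1} \<subseteq> es ! i \<inter> U \<and>
           (\<forall>t\<in>{0..<1}. \<phi> (g t) \<in> ball (\<phi> v) r) \<and>
           \<phi> (g 1) = \<phi> v + of_real r * cis (\<theta> i)) \<and>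
        (\<forall>i j. i < j \<and> j < length es \<longrightarrow> \<theta> i < \<theta> j \<and> \<theta> j < \<theta> i + 2 * pi))"

section \<open>Closures of e-pegs\<close>

record ('v, 'e) egraph =
  everts :: "'v set"
  eedges :: "'e set"
  eends :: "'e \<Rightarrow> 'v set"
  elabel :: "'e \<Rightarrow> nat"

definition is_egraph :: "nat \<Rightarrow> ('v, 'e) egraph \<Rightarrow> bool" where
  "is_egraph m G \<longleftrightarrow>
     finite (everts G) \<and> finite (eedges G) \<and>
     (\<forall>e\<in>eedges G. eends G e \<subseteq> everts G \<and> card (eends G e) = 2) \<and>
     bij_betw (elabel G) (eedges G) {1..m}"

text \<open>The edges at \<open>v\<close> in the order in which, in the properly embedded graph \<open>P(G)\<close>, they leave \<open>v\<close>
  counterclockwise from the right in the half-plane model of the disc around \<open>v\<close>.\<close>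

definition peg_order :: "('v, 'e) egraph \<Rightarrow> 'v \<Rightarrow> 'e list" where
  "peg_order G v = sorted_key_list_of_set (elabel G) {e \<in> eedges G. v \<in> eends G e}"

text \<open>The closure of \<open>P(G)\<close> is the ceg with graph \<open>G\<close> whose rotation system is obtained by completing
  the linear order \<open>peg_order G v\<close> at each vertex to a cyclic order. A ceg is determined by its
  rotation system up to orientation-preserving homeomorphism restricting to a graph isomorphism, and
  cegs are identified under these homeomorphisms; hence \<open>C\<close> is this closure iff a graph isomorphism,
  given by \<open>f\<close> on vertices and \<open>h\<close> on edges, carries the one rotation system to the other.\<close>

definition is_closure_of_peg :: "'a embedded_graph \<Rightarrow> ('v, 'e) egraph \<Rightarrow> bool" where
  "is_closure_of_peg C G \<longleftrightarrow>
     (\<exists>f h. bij_betw f (everts G) (verts C) \<and> bij_betw h (eedges G) (edges C) \<and>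
        (\<forall>e\<in>eedges G. h e \<inter> verts C = f ` eends G e) \<and>
        (\<forall>v\<in>everts G. ccw_order C (f v) (map h (peg_order G v))))"

text \<open>Every finite graph is isomorphic to one with natural numbers as vertices and edges, so the
  choice of types for \<open>G\<close> is no restriction.\<close>

definition closure_of_epeg :: "'a embedded_graph \<Rightarrow> bool" where
  "closure_of_epeg C \<longleftrightarrow>
     (\<exists>m. \<exists>G :: (nat, nat) egraph. is_egraph m G \<and> is_closure_of_peg C G)"

end

theory Submission
  imports Defs
begin

text \<open>
  Halve every edge by a vertex at its parameter \<open>1/2\<close>. Each half has exactly one end among the original
  vertices, so the edges of the halved graph are partitioned into the stars of the original vertices.
  Cut the cyclic order at each original vertex anywhere into a linear order, concatenate these linear
  orders, and label the halves by their positions in the concatenation. At an original vertex the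
  labels then induce the chosen linear order. At a midpoint they induce some linear order of two
  edges, and two edges have only one cyclic order. This is \<open>closure_of_epeg_halved\<close>. In the
  original graph the same labelling could fail, since the two ends of an edge may demand incompatible
  positions for it; halving separates these demands.

  Two topological facts support this combinatorial argument. Halving keeps the point set of the graph,
  hence the faces, so the halved graph is again a ceg (\<open>ceg_halved\<close>). And the edges at a vertex \<open>v\<close>
  of a ceg do have a counterclockwise order in the sense of \<open>ccw_order\<close> (\<open>ceg_has_ccw_order\<close>):
  inside a chart, choose a circle around \<open>v\<close> so small that the closed disc contains no
  other vertex. Every edge at \<open>v\<close> ends outside the disc, so it has a first point on the circle, and the
  first points of different edges are different because edges meet only in vertices. Sorting the edges
  by the arguments of these points gives the order.
\<close>

section \<open>Arcs\<close>

lemma is_arc_paramD: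
  assumes "is_arc_param X e g"
  shows "continuous_map (top_of_set {0..1}) X g" "inj_on g {0..1}" "g ` {0..1} = e"
    "e \<subseteq> topspace X"
proof -
  have h: "homeomorphic_map (top_of_set {0..1}) (subtopology X (g ` {0..1})) g"
    using assms unfolding is_arc_param_def embedding_map_def topspace_euclidean_subtopology by blast
  show c: "continuous_map (top_of_set {0..1}) X g"
    using homeomorphic_imp_continuous_map[OF h] continuous_map_in_subtopology by blast
  show "inj_on g {0..1}" using homeomorphic_imp_injective_map[OF h] by simp
  show e: "g ` {0..1} = e" using assms by (simp add: is_arc_param_def)
  show "e \<subseteq> topspace X" using continuous_map_image_subset_topspace[OF c] e by simp
qed

text \<open>Taking \<open>a > b\<close> reverses the direction; this is used to let an edge start at either end.\<close>

lemma is_arc_param_subarc: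
  assumes X: "Hausdorff_space X" and g: "is_arc_param X e g"
    and a: "a \<in> {0..1}" and b: "b \<in> {0..1}" and "a \<noteq> b"
  shows "is_arc_param X (g ` closed_segment a b) (\<lambda>t. g ((1 - t) * a + t * b))"
proof -
  let ?l = "\<lambda>t::real. (1 - t) * a + t * b"
  have im: "?l ` {0..1} = closed_segment a b"
    by (auto simp: closed_segment_def)
  have sub: "closed_segment a b \<subseteq> {0..1}"
    using a b by (auto simp: closed_segment_eq_real_ivl)
  have "continuous_map (top_of_set {0..1}) (top_of_set {0..1}) ?l"
    using im sub by (auto intro!: continuous_intros)
  then have c: "continuous_map (top_of_set {0..1}) X (g \<circ> ?l)"
    using continuous_map_compose is_arc_paramD(1)[OF g] by blast
  have "inj_on ?l {0..1}"
  proof (rule inj_onI)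
    fix s t assume "?l s = ?l t"
    then have "(s - t) * (b - a) = 0" by (simp add: algebra_simps)
    with \<open>a \<noteq> b\<close> show "s = t" by simp
  qed
  moreover have "inj_on g (?l ` {0..1})"
    using is_arc_paramD(2)[OF g] im sub inj_on_subset by blast
  ultimately have "inj_on (g \<circ> ?l) {0..1}" by (rule comp_inj_on)
  with c X have "embedding_map (top_of_set {0..1}) X (g \<circ> ?l)"
    by (intro continuous_imp_embedding_map) (auto simp: compact_space_subtopology)
  moreover have "(g \<circ> ?l) ` {0..1} = g ` closed_segment a b"
    using im by (metis image_comp)
  ultimately show ?thesis
    by (simp add: is_arc_param_def comp_def)
qed

section \<open>Counterclockwise orders at a vertex\<close>

text \<open>The requirement that \<open>ccw_order\<close> makes of each single edge \<open>e\<close>, with \<open>z\<close> the first point of \<open>e\<close> on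
  the circle.\<close>

definition reaches_circle ::
  "'a topology \<Rightarrow> 'a set \<Rightarrow> ('a \<Rightarrow> complex) \<Rightarrow> 'a \<Rightarrow> real \<Rightarrow> 'a set \<Rightarrow> complex \<Rightarrow> bool" where
  "reaches_circle X U \<phi> v r e z \<longleftrightarrow>
     (\<exists>g :: real \<Rightarrow> 'a. embedding_map (top_of_set {0..1}) X g \<and>
        g 0 = v \<and> g ` {0..1} \<subseteq> e \<inter> U \<and>
        (\<forall>t\<in>{0..<1}. \<phi> (g t) \<in> ball (\<phi> v) r) \<and> \<phi> (g 1) = z)"

lemma ccw_order_iff_reaches_circle:
  "ccw_order C v es \<longleftrightarrow>
     distinct es \<and> set es = {e \<in> edges C. v \<in> e} \<and>
     (\<exists>U \<phi> r \<theta>. (U, \<phi>) \<in> atlas C \<and> r > 0 \<and> v \<in> U \<and> cball (\<phi> v) r \<subseteq> \<phi> ` U \<and>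
        (\<forall>i<length es. reaches_circle (surface C) U \<phi> v r (es ! i)
                          (\<phi> v + of_real r * cis (\<theta> i))) \<and>
        (\<forall>i j. i < j \<and> j < length es \<longrightarrow> \<theta> i < \<theta> j \<and> \<theta> j < \<theta> i + 2 * pi))"
proof -
  have "(\<exists>(U, \<phi>)\<in>A. \<exists>r>0. \<exists>\<theta>. Q U \<phi> r \<theta>) \<longleftrightarrow>
        (\<exists>U \<phi> r \<theta>. (U, \<phi>) \<in> A \<and> r > 0 \<and> Q U \<phi> r \<theta>)"
    for A :: "('a set \<times> ('a \<Rightarrow> complex)) set" and Q :: "_ \<Rightarrow> _ \<Rightarrow> real \<Rightarrow> (nat \<Rightarrow> real) \<Rightarrow> bool"
    by blast
  then show ?thesis
    unfolding ccw_order_def reaches_circle_def by (rule arg_cong)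
qed

text \<open>The list stands for a cyclic order: the first edge may be moved to the end if one full turn is
  added to its angle.\<close>

lemma ccw_order_rotate:
  assumes "ccw_order C v (x # xs)"
  shows "ccw_order C v (xs @ [x])"
proof -
  let ?n = "length xs"
  from assms obtain U \<phi> r \<theta> where A: "(U, \<phi>) \<in> atlas C" "r > 0" "v \<in> U" "cball (\<phi> v) r \<subseteq> \<phi> ` U"
    and all_arcs: "\<forall>i<length (x # xs). reaches_circle (surface C) U \<phi> v r ((x # xs) ! i)
                 (\<phi> v + of_real r * cis (\<theta> i))"
    and all_ord: "\<forall>i j. i < j \<and> j < length (x # xs) \<longrightarrow> \<theta> i < \<theta> j \<and> \<theta> j < \<theta> i + 2 * pi"
    unfolding ccw_order_iff_reaches_circle by (elim conjE exE)
  have arcs: "reaches_circle (surface C) U \<phi> v r ((x # xs) ! i) (\<phi> v + of_real r * cis (\<theta> i))"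
    if "i < Suc ?n" for i
    using all_arcs that by simp
  have ord: "\<theta> i < \<theta> j \<and> \<theta> j < \<theta> i + 2 * pi" if "i < j" "j < Suc ?n" for i j
    using all_ord that by simp
  define \<theta>' where "\<theta>' i = (if i < ?n then \<theta> (Suc i) else \<theta> 0 + 2 * pi)" for i
  have per: "cis (\<theta> 0 + 2 * pi) = cis (\<theta> 0)"
    by (simp add: complex_eq_iff)
  have "reaches_circle (surface C) U \<phi> v r ((xs @ [x]) ! i) (\<phi> v + of_real r * cis (\<theta>' i))"
    if "i < length (xs @ [x])" for i
  proof (cases "i < ?n")
    case True
    then show ?thesis using arcs[of "Suc i"] by (simp add: \<theta>'_def nth_append)
  next
    case False
    with that have "i = ?n" by simp
    then show ?thesis using arcs[of 0] per by (simp add: \<theta>'_def)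
  qed
  moreover have "\<theta>' i < \<theta>' j \<and> \<theta>' j < \<theta>' i + 2 * pi" if "i < j \<and> j < length (xs @ [x])" for i j
    using that ord[of "Suc i" "Suc j"] ord[of 0 "Suc i"] by (auto simp: \<theta>'_def)
  moreover have "distinct (xs @ [x])" "set (xs @ [x]) = {e \<in> edges C. v \<in> e}"
    using assms unfolding ccw_order_def by auto
  ultimately show ?thesis
    unfolding ccw_order_iff_reaches_circle using A by blast
qed

text \<open>The two lists of two elements are rotations of each other. Hence the labels of the two halves of an
  edge never matter at the midpoint.\<close>

lemma ccw_order_two_edges:
  assumes "ccw_order C v es" and "distinct es'" and "set es' = set es" and "length es = 2"
  shows "ccw_order C v es'"
proof -
  obtain x y where es: "es = [x, y]"
    using assms(4) by (metis One_nat_def Suc_1 length_0_conv length_Suc_conv)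
  have "x \<noteq> y" using assms(1) es by (auto simp: ccw_order_def)
  have "length es' = 2"
    using assms(2,3) es \<open>x \<noteq> y\<close> by (metis card_2_iff distinct_card list.simps(15) empty_set)
  then obtain x' y' where es': "es' = [x', y']"
    by (metis One_nat_def Suc_1 length_0_conv length_Suc_conv)
  have "es' = [x, y] \<or> es' = [y, x]"
    using assms(2,3) es es' by (auto simp: doubleton_eq_iff)
  then show ?thesis
    using assms(1) ccw_order_rotate[of C v x "[y]"] es by auto
qed

text \<open>The initial segment wanted by \<open>reaches_circle\<close> ends at the first time \<open>s\<close> at which the arc is outside
  the open disc \<open>B\<close>. The arc may leave the chart later on, so it has to be shown that the
  point \<open>g s\<close> still lies in the chart. This holds because the closed disc \<open>K\<close> is compact, hence closed in the
  whole (Hausdorff) surface.\<close>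

lemma arc_reaches_circle:
  assumes X: "Hausdorff_space X" and chart: "planar_chart X U \<phi>"
    and v: "v \<in> U" and "r > 0" and cb: "cball (\<phi> v) r \<subseteq> \<phi> ` U"
    and g: "is_arc_param X e g" and g0: "g 0 = v"
    and g1: "g 1 \<in> U \<Longrightarrow> r < dist (\<phi> v) (\<phi> (g 1))"
  shows "\<exists>p\<in>e \<inter> U. dist (\<phi> v) (\<phi> p) = r \<and> reaches_circle X U \<phi> v r e (\<phi> p)"
proof -
  have U: "openin X U" and hom: "homeomorphic_map (subtopology X U) (top_of_set (\<phi> ` U)) \<phi>"
    using chart by (auto simp: planar_chart_def)
  have UX: "U \<subseteq> topspace X" by (rule openin_subset[OF U])
  then have tU: "topspace (subtopology X U) = U" by auto
  define B where "B = {x \<in> U. \<phi> x \<in> ball (\<phi> v) r}"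
  define K where "K = {x \<in> U. \<phi> x \<in> cball (\<phi> v) r}"
  have imB: "\<phi> ` B = ball (\<phi> v) r" and imK: "\<phi> ` K = cball (\<phi> v) r"
    using cb by (force simp: B_def K_def)+
  have "openin (top_of_set (\<phi> ` U)) (\<phi> ` B)"
    unfolding imB using cb by (intro open_subset) auto
  then have "openin (subtopology X U) B"
    using homeomorphic_map_openness[OF hom, of B] tU by (auto simp: B_def)
  then have openB: "openin X B"
    using openin_trans_full U by blast
  have "compactin (top_of_set (\<phi> ` U)) (\<phi> ` K)"
    unfolding imK using cb by (simp add: compactin_subtopology)
  then have "compactin (subtopology X U) K"
    using homeomorphic_map_compactness[OF hom, of K] tU by (auto simp: K_def)
  then have closedK: "closedin X K"
    using X compactin_imp_closedin compactin_subtopology by blast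
  note gc = is_arc_paramD(1)[OF g]
  define T where "T = {t \<in> {0..1}. g t \<notin> B}"
  have "openin (top_of_set {0..1}) {t \<in> {0..1}. g t \<in> B}"
    using openin_continuous_map_preimage[OF gc openB] by simp
  then have "closedin (top_of_set {0..1}) ({0..1} - {t \<in> {0..1}. g t \<in> B})"
    by (intro closedin_diff) auto
  also have "{0..1} - {t \<in> {0..1}. g t \<in> B} = T" by (auto simp: T_def)
  finally have closedT: "closed T"
    using closedin_closed_trans by blast
  have "1 \<in> T" using g1 by (auto simp: T_def B_def)
  have bddT: "bdd_below T" by (rule bdd_belowI[of _ 0]) (simp add: T_def)
  define s where "s = Inf T"
  have sT: "s \<in> T"
    unfolding s_def using closed_contains_Inf \<open>1 \<in> T\<close> bddT closedT by blast
  have "g 0 \<in> B" using g0 v \<open>r > 0\<close> by (simp add: B_def)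
  with sT have s: "0 < s" "s \<le> 1"
    by (auto simp: T_def order.order_iff_strict)
  have before: "g t \<in> B" if "0 \<le> t" "t < s" for t
  proof (rule ccontr)
    assume "g t \<notin> B"
    with that s have "t \<in> T" by (simp add: T_def)
    then have "s \<le> t" unfolding s_def using bddT by (rule cInf_lower)
    with that show False by simp
  qed
  \<comment> \<open>By continuity \<open>g s\<close> is still in the closed disc, hence in the chart.\<close>
  have "closedin (top_of_set {0..1}) {t \<in> {0..1}. g t \<in> K}"
    using closedin_continuous_map_preimage[OF gc closedK] by simp
  then have "closed {t \<in> {0..1}. g t \<in> K}"
    using closedin_closed_trans by blast
  moreover have "{0..<s} \<subseteq> {t \<in> {0..1}. g t \<in> K}"
    using before s by (force simp: B_def K_def)
  ultimately have "closure {0..<s} \<subseteq> {t \<in> {0..1}. g t \<in> K}"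
    by (rule closure_minimal[rotated])
  then have "s \<in> {t \<in> {0..1}. g t \<in> K}" using s by (auto simp: subset_iff)
  then have "g s \<in> K" by simp
  moreover have "g s \<notin> B" using sT by (simp add: T_def)
  ultimately have gs: "g s \<in> U" "dist (\<phi> v) (\<phi> (g s)) = r" 
    by (auto simp: B_def K_def)
  define h where "h t = g ((1 - t) * 0 + t * s)" for t
  have "is_arc_param X (g ` closed_segment 0 s) h"
    unfolding h_def using s by (intro is_arc_param_subarc[OF X g]) auto
  then have h: "embedding_map (top_of_set {0..1}) X h" "h ` {0..1} = g ` {0..s}"
    using s by (auto simp: is_arc_param_def closed_segment_eq_real_ivl)
  have "g ` {0..s} \<subseteq> e"
    using is_arc_paramD(3)[OF g] s by force
  moreover have "g t \<in> U" if "t \<in> {0..s}" for t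
    using before[of t] gs(1) that by (cases "t = s") (auto simp: B_def)
  ultimately have "h ` {0..1} \<subseteq> e \<inter> U" using h(2) by auto
  moreover have "\<phi> (h t) \<in> ball (\<phi> v) r" if "t \<in> {0..<1}" for t
  proof -
    have "t * s < s" using that s by simp
    then show ?thesis using before[of "t * s"] that s by (simp add: h_def B_def)
  qed
  ultimately have "reaches_circle X U \<phi> v r e (\<phi> (g s))"
    unfolding reaches_circle_def using h(1) g0 by (intro exI[of _ h]) (auto simp: h_def)
  moreover have "g s \<in> e" using \<open>g ` {0..s} \<subseteq> e\<close> s by auto
  ultimately show ?thesis using gs by blast
qed

lemma ceg_edge_param:
  assumes "ceg C" and "e \<in> edges C"
  obtains g where "is_arc_param (surface C) e g" "e \<inter> verts C = {g 0, g 1}" "g 0 \<noteq> g 1"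
proof -
  have "\<forall>e\<in>edges C. \<exists>g. is_arc_param (surface C) e g \<and> e \<inter> verts C = {g 0, g 1}"
    using assms(1) by (simp add: ceg_def)
  then obtain g where g: "is_arc_param (surface C) e g" "e \<inter> verts C = {g 0, g 1}"
    using assms(2) by blast
  then have "g 0 \<noteq> g 1" using inj_onD[OF is_arc_paramD(2)[OF g(1)], of 0 1] by auto
  with g that show thesis by blast
qed

lemma ceg_edges_meet_in_vertices:
  assumes "ceg C" and "e \<in> edges C" "f \<in> edges C" "e \<noteq> f"
  shows "e \<inter> f \<subseteq> verts C"
proof -
  have "\<forall>e\<in>edges C. \<forall>f\<in>edges C. e \<noteq> f \<longrightarrow> e \<inter> f \<subseteq> verts C"
    using assms(1) by (simp add: ceg_def)
  with assms(2-4) show ?thesis by blast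
qed

lemma ceg_arc_from_vertex:
  assumes C: "ceg C" and e: "e \<in> edges C" and v: "v \<in> verts C" "v \<in> e"
  obtains g where "is_arc_param (surface C) e g" "g 0 = v" "g 1 \<in> verts C - {v}"
proof -
  have X: "Hausdorff_space (surface C)"
    using C by (simp add: ceg_def closed_oriented_surface_def)
  obtain g where g: "is_arc_param (surface C) e g" and ends: "e \<inter> verts C = {g 0, g 1}"
    and ne: "g 0 \<noteq> g 1"
    using ceg_edge_param[OF C e] .
  have mem: "v = g 0 \<or> v = g 1" "g 0 \<in> verts C" "g 1 \<in> verts C" using v ends by auto
  show ?thesis
  proof (cases "v = g 0")
    case True
    then show ?thesis using that[of g] g ne mem by auto
  next
    case False
    have "is_arc_param (surface C) (g ` closed_segment 1 0) (\<lambda>t. g ((1 - t) * 1 + t * 0))"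
      by (rule is_arc_param_subarc[OF X g]) auto
    moreover have "g ` closed_segment 1 0 = e"
      using is_arc_paramD(3)[OF g] by (simp add: closed_segment_eq_real_ivl)
    ultimately have "is_arc_param (surface C) e (\<lambda>t. g (1 - t))" by simp
    then show ?thesis using that[of "\<lambda>t. g (1 - t)"] ne mem False by auto
  qed
qed

lemma ex_distinct_list_increasing_key:
  fixes f :: "'b \<Rightarrow> real"
  assumes "finite A" "inj_on f A"
  shows "\<exists>xs. distinct xs \<and> set xs = A \<and> sorted_wrt (\<lambda>x y. f x < f y) xs"
proof -
  obtain ys where ys: "distinct ys" "set ys = A"
    using finite_distinct_list[OF assms(1)] by blast
  then have "distinct (map f (sort_key f ys))"
    using assms(2) by (simp add: distinct_map)
  then have "sorted_wrt (<) (map f (sort_key f ys))"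
    by (simp add: strict_sorted_iff)
  with ys show ?thesis
    by (intro exI[of _ "sort_key f ys"]) (simp add: sorted_wrt_map)
qed

text \<open>On a small enough circle the first points of the edges at \<open>v\<close> are distinct,
  and sorting by their arguments, which lie in a half-open interval of length \<open>2 * pi\<close>, orders the edges.\<close>

lemma ceg_has_ccw_order:
  assumes C: "ceg C" and v: "v \<in> verts C"
  shows "\<exists>es. ccw_order C v es"
proof -
  let ?X = "surface C"
  let ?E = "{e \<in> edges C. v \<in> e}"
  have S: "closed_oriented_surface ?X (atlas C)" and fin: "finite (verts C)" "finite (edges C)"
    and vX: "v \<in> topspace ?X"
    using C v by (auto simp: ceg_def)
  have disj: "e \<inter> f \<subseteq> verts C" if "e \<in> edges C" "f \<in> edges C" "e \<noteq> f" for e f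
    using ceg_edges_meet_in_vertices[OF C that] .
  have X: "Hausdorff_space ?X" using S by (simp add: closed_oriented_surface_def)
  obtain U \<phi> where chart: "(U, \<phi>) \<in> atlas C" "planar_chart ?X U \<phi>" "v \<in> U"
    using S vX unfolding closed_oriented_surface_def by blast
  have "inj_on \<phi> (topspace ?X \<inter> U)"
    using chart(2) homeomorphic_imp_injective_map[of "subtopology ?X U"]
    by (auto simp: planar_chart_def)
  moreover have "U \<subseteq> topspace ?X"
    using chart(2) openin_subset unfolding planar_chart_def by blast
  ultimately have inj: "inj_on \<phi> U" by (simp add: Int_absorb1)
  have "open (\<phi> ` U)" using chart(2) by (simp add: planar_chart_def)
  then obtain r0 where r0: "r0 > 0" "cball (\<phi> v) r0 \<subseteq> \<phi> ` U"
    using chart(3) open_contains_cball by blast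
  let ?W = "\<phi> ` ((verts C - {v}) \<inter> U)"
  obtain r1 where r1: "r1 > 0" "\<forall>z\<in>?W. z \<noteq> \<phi> v \<longrightarrow> r1 \<le> dist (\<phi> v) z"
    using finite_set_avoid[of ?W "\<phi> v"] fin by auto
  \<comment> \<open>Half of \<open>r1\<close> keeps the other vertices strictly outside the closed disc.\<close>
  define r where "r = min r0 (r1 / 2)"
  have r: "r > 0" "cball (\<phi> v) r \<subseteq> \<phi> ` U"
    using r0 r1(1) unfolding r_def by auto
  have far: "r < dist (\<phi> v) (\<phi> w)" if "w \<in> verts C - {v}" "w \<in> U" for w
  proof -
    have "\<phi> w \<noteq> \<phi> v" using inj that chart(3) by (auto simp: inj_on_def)
    then have "r1 \<le> dist (\<phi> v) (\<phi> w)" using r1(2) that by blast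
    then show ?thesis using r1(1) by (auto simp: r_def min_def)
  qed
  have "\<exists>p\<in>e \<inter> U. dist (\<phi> v) (\<phi> p) = r \<and> reaches_circle ?X U \<phi> v r e (\<phi> p)" if "e \<in> ?E" for e
  proof -
    obtain g where g: "is_arc_param ?X e g" "g 0 = v" "g 1 \<in> verts C - {v}"
      using ceg_arc_from_vertex[OF C _ v] \<open>e \<in> ?E\<close> by blast
    show ?thesis
      by (rule arc_reaches_circle[OF X chart(2,3) r g(1,2)]) (use far g(3) in auto)
  qed
  then have "\<forall>e\<in>?E. \<exists>q. q \<in> e \<inter> U \<and> dist (\<phi> v) (\<phi> q) = r \<and>
      reaches_circle ?X U \<phi> v r e (\<phi> q)" by blast
  from bchoice[OF this] obtain p
    where p_all: "\<forall>e\<in>?E. p e \<in> e \<inter> U \<and> dist (\<phi> v) (\<phi> (p e)) = r \<and>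
      reaches_circle ?X U \<phi> v r e (\<phi> (p e))" ..
  then have p: "\<And>e. e \<in> ?E \<Longrightarrow> p e \<in> e \<inter> U"
    and on_circle: "\<And>e. e \<in> ?E \<Longrightarrow> dist (\<phi> v) (\<phi> (p e)) = r"
    and reach: "\<And>e. e \<in> ?E \<Longrightarrow> reaches_circle ?X U \<phi> v r e (\<phi> (p e))"
    by blast+
  define \<alpha> where "\<alpha> e = Arg (\<phi> (p e) - \<phi> v)" for e
  have polar: "\<phi> (p e) = \<phi> v + of_real r * cis (\<alpha> e)" if "e \<in> ?E" for e
    using rcis_cmod_Arg[of "\<phi> (p e) - \<phi> v"] on_circle[OF that]
    by (simp add: \<alpha>_def rcis_def dist_norm norm_minus_commute algebra_simps)
  \<comment> \<open>A common first point would be a common point of two edges, so a vertex, on the circle.\<close>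
  have "inj_on \<alpha> ?E"
  proof (rule inj_onI)
    fix e f assume e: "e \<in> ?E" and f: "f \<in> ?E" and "\<alpha> e = \<alpha> f"
    then have "\<phi> (p e) = \<phi> (p f)" using polar by simp
    then have eq: "p e = p f" using inj p[OF e] p[OF f] by (auto simp: inj_on_def)
    show "e = f"
    proof (rule ccontr)
      assume "e \<noteq> f"
      then have "p e \<in> verts C" using disj[of e f] e f p[OF e] p[OF f] eq by auto
      moreover have "p e \<noteq> v" using on_circle[OF e] r(1) by auto
      ultimately have "r < dist (\<phi> v) (\<phi> (p e))" using far p[OF e] by blast
      then show False using on_circle[OF e] by simp
    qed
  qed
  then obtain es where es: "distinct es" "set es = ?E" "sorted_wrt (\<lambda>e f. \<alpha> e < \<alpha> f) es"
    using ex_distinct_list_increasing_key[of ?E \<alpha>] fin by auto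
  have angles: "\<alpha> (es ! i) < \<alpha> (es ! j) \<and> \<alpha> (es ! j) < \<alpha> (es ! i) + 2 * pi" if "i < j \<and> j < length es" for i j
  proof -
    have "\<alpha> (es ! j) \<le> pi" "- pi < \<alpha> (es ! i)"
      unfolding \<alpha>_def using Arg_bounded by auto
    then show ?thesis using that sorted_wrt_nth_less[OF es(3)] by auto
  qed
  have arcs: "reaches_circle ?X U \<phi> v r (es ! i) (\<phi> v + of_real r * cis (\<alpha> (es ! i)))"
    if "i < length es" for i
  proof -
    have "es ! i \<in> ?E" using that es(2) nth_mem by blast
    then show ?thesis using reach polar by simp
  qed
  have "ccw_order C v es"
    unfolding ccw_order_iff_reaches_circle
    by (intro conjI exI[of _ U] exI[of _ \<phi>] exI[of _ r] exI[of _ "\<lambda>i. \<alpha> (es ! i)"])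
      (use es(1,2) chart(1,3) r arcs angles in simp_all)
  then show ?thesis ..
qed

section \<open>Labels from a list of the edges\<close>

lemma (in linorder) sorted_key_list_of_set_eq_self:
  assumes "inj_on f (set xs)" and "sorted (map f xs)" and "distinct xs"
  shows "sorted_key_list_of_set f (set xs) = xs"
proof -
  interpret folding_insort_key "(\<le>)" "(<)" "set xs" f
    by unfold_locales (rule assms(1))
  show ?thesis using assms(2,3) by (intro idem_if_sorted_distinct) auto
qed

text \<open>Number the vertices arbitrarily and let the edges of the e-graph be the positions in \<open>L\<close>. The
  labels increase along \<open>L\<close>, so the order that they induce at \<open>v\<close> is the sublist of \<open>L\<close> of the
  edges at \<open>v\<close>. This turns the search for an e-graph into the search for one list.\<close>

lemma closure_of_epeg_if_listed:
  assumes C: "ceg C" and L: "distinct L" "set L = edges C"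
    and ord: "\<And>v. v \<in> verts C \<Longrightarrow> ccw_order C v (filter (\<lambda>e. v \<in> e) L)"
  shows "closure_of_epeg C"
proof -
  let ?m = "length L"
  have "finite (verts C)" using C by (simp add: ceg_def)
  then obtain f :: "nat \<Rightarrow> 'a" where f: "bij_betw f {..<card (verts C)} (verts C)"
    using ex_bij_betw_nat_finite by (metis atLeast0LessThan)
  let ?f' = "inv_into {..<card (verts C)} f"
  define G :: "(nat, nat) egraph" where
    "G = \<lparr>everts = {..<card (verts C)}, eedges = {..<?m},
          eends = (\<lambda>i. ?f' ` (L ! i \<inter> verts C)), elabel = Suc\<rparr>"
  have f': "bij_betw ?f' (verts C) {..<card (verts C)}"
    by (rule bij_betw_inv_into[OF f])
  have ends: "f ` eends G i = L ! i \<inter> verts C" for i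
  proof -
    have "f ` ?f' ` (L ! i \<inter> verts C) = L ! i \<inter> verts C"
      using f by (intro image_inv_into_cancel) (auto simp: bij_betw_def)
    then show ?thesis by (simp add: G_def)
  qed
  have at: "v \<in> eends G i \<longleftrightarrow> f v \<in> L ! i" if "v \<in> everts G" for v i
  proof -
    have sub: "eends G i \<subseteq> {..<card (verts C)}"
      using f' by (auto simp: G_def bij_betw_def)
    have v: "v \<in> {..<card (verts C)}" using that by (simp add: G_def)
    have "f v \<in> verts C" using f v by (auto simp: bij_betw_def)
    moreover have "v \<in> eends G i \<longleftrightarrow> f v \<in> f ` eends G i"
      using f sub v by (meson bij_betw_def inj_on_image_mem_iff)
    ultimately show ?thesis using ends by auto
  qed
  have "card (eends G i) = 2" if "i \<in> eedges G" for i
  proof -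
    have "i < ?m" using that by (simp add: G_def)
    then have "L ! i \<in> set L" by (rule nth_mem)
    then have "L ! i \<in> edges C" unfolding L(2) .
    from ceg_edge_param[OF C this] obtain g
      where "is_arc_param (surface C) (L ! i) g" "L ! i \<inter> verts C = {g 0, g 1}" "g 0 \<noteq> g 1" .
    then have "card (L ! i \<inter> verts C) = 2" by simp
    moreover have "card (eends G i) = card (L ! i \<inter> verts C)"
      using inj_on_subset[OF bij_betw_imp_inj_on[OF f'], of "L ! i \<inter> verts C"]
      by (simp add: G_def card_image)
    ultimately show ?thesis by simp
  qed
  moreover have "eends G i \<subseteq> everts G" for i
    using f' by (auto simp: G_def bij_betw_def)
  moreover have "bij_betw Suc {..<?m} {1..?m}"
    by (simp add: bij_betw_def image_Suc_lessThan)
  ultimately have G: "is_egraph ?m G"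
    by (auto simp: is_egraph_def G_def)
  have peg: "map ((!) L) (peg_order G v) = filter (\<lambda>e. f v \<in> e) L" if "v \<in> everts G" for v
  proof -
    let ?is = "filter (\<lambda>i. f v \<in> L ! i) [0..<?m]"
    have "sorted (map Suc ?is)"
      by (simp add: sorted_wrt_map sorted_wrt_filter)
    then have "sorted_key_list_of_set Suc (set ?is) = ?is"
      by (intro sorted_key_list_of_set_eq_self) auto
    moreover have "set ?is = {e \<in> eedges G. v \<in> eends G e}"
      using at[OF that] by (auto simp: G_def)
    ultimately have "peg_order G v = ?is"
      by (simp add: peg_order_def) (simp add: G_def)
    also have "map ((!) L) ?is = filter (\<lambda>e. f v \<in> e) (map ((!) L) [0..<?m])"
      by (simp add: filter_map comp_def)
    finally show ?thesis by (simp only: map_nth)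
  qed
  have "is_closure_of_peg C G"
    unfolding is_closure_of_peg_def
  proof (intro exI[of _ f] exI[of _ "(!) L"] conjI ballI)
    show "bij_betw f (everts G) (verts C)" using f by (simp add: G_def)
    show "bij_betw ((!) L) (eedges G) (edges C)"
      using bij_betw_nth[OF L(1) refl L(2)[symmetric]] by (simp add: G_def)
    show "L ! i \<inter> verts C = f ` eends G i" for i using ends by simp
    fix v assume v: "v \<in> everts G"
    then have "f v \<in> verts C" using f by (auto simp: G_def bij_betw_def)
    then show "ccw_order C (f v) (map ((!) L) (peg_order G v))"
      using peg[OF v] ord by simp
  qed
  with G show ?thesis unfolding closure_of_epeg_def by blast
qed

text \<open>Orders chosen independently on disjoint sets extend to one order of the union: concatenate.\<close>

lemma ex_list_filter_eq_of_disjoint: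
  assumes "finite V" and "\<And>v. v \<in> V \<Longrightarrow> distinct (ls v)"
    and "\<And>v w. v \<in> V \<Longrightarrow> w \<in> V \<Longrightarrow> v \<noteq> w \<Longrightarrow> set (ls v) \<inter> set (ls w) = {}"
  shows "\<exists>L. distinct L \<and> set L = (\<Union>v\<in>V. set (ls v)) \<and>
           (\<forall>v\<in>V. filter (\<lambda>x. x \<in> set (ls v)) L = ls v)"
  using assms
proof (induction V)
  case empty
  then show ?case by simp
next
  case (insert w V)
  then obtain L where L: "distinct L" "set L = (\<Union>v\<in>V. set (ls v))"
    "\<forall>v\<in>V. filter (\<lambda>x. x \<in> set (ls v)) L = ls v"
    by (auto 0 4)
  have disj: "set (ls w) \<inter> set (ls v) = {}" if "v \<in> V" for v
    using insert.prems(2)[of w v] insert.hyps that by auto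
  have "distinct (ls w @ L)" "set (ls w @ L) = (\<Union>v\<in>insert w V. set (ls v))"
    using L(1,2) insert.prems(1)[of w] disj by auto
  moreover have "filter (\<lambda>x. x \<in> set (ls v)) (ls w @ L) = ls v" if "v \<in> insert w V" for v
  proof (cases "v = w")
    case True
    have "filter (\<lambda>x. x \<in> set (ls w)) L = []"
      using L(2) disj by (auto simp: filter_empty_conv)
    then show ?thesis using True by simp
  next
    case False
    with that have "v \<in> V" by simp
    then have "filter (\<lambda>x. x \<in> set (ls v)) (ls w) = []"
      using disj by (auto simp: filter_empty_conv)
    then show ?thesis using L(3) \<open>v \<in> V\<close> by simp
  qed
  ultimately show ?case by blast
qed

section \<open>Halving the edges\<close>

text \<open>An edge of a ceg is only known to have some parametrization. Its midpoint depends on the choice of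
  one, which \<open>P\<close> fixes for all edges.\<close>

locale parametrized_ceg =
  fixes C :: "'a embedded_graph" and P :: "'a set \<Rightarrow> real \<Rightarrow> 'a"
  assumes ceg: "ceg C"
    and param: "\<And>e. e \<in> edges C \<Longrightarrow> is_arc_param (surface C) e (P e)"
    and param_ends: "\<And>e. e \<in> edges C \<Longrightarrow> e \<inter> verts C = {P e 0, P e 1}"
begin

definition half_domains :: "real set set" where
  "half_domains = {{0..1/2}, {1/2..1}}"

definition halved :: "'a embedded_graph" where
  "halved = C\<lparr>verts := verts C \<union> (\<lambda>e. P e (1/2)) ` edges C,
              edges := (\<lambda>(e, I). P e ` I) ` (edges C \<times> half_domains)\<rparr>"

lemma halved_sel:
  "surface halved = surface C" "atlas halved = atlas C"
  "verts halved = verts C \<union> (\<lambda>e. P e (1/2)) ` edges C"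
  "edges halved = (\<lambda>(e, I). P e ` I) ` (edges C \<times> half_domains)"
  by (simp_all add: halved_def)

lemma halved_edge_cases:
  assumes "h \<in> edges halved"
  obtains e I where "e \<in> edges C" "I \<in> half_domains" "h = P e ` I"
  using assms by (auto simp: halved_sel)

lemma Hausdorff: "Hausdorff_space (surface C)"
  using ceg by (simp add: ceg_def closed_oriented_surface_def)

lemma half_domain_cases:
  assumes "I \<in> half_domains"
  obtains b where "b \<in> {0, 1}" "I = closed_segment b (1/2)" "I \<subseteq> {0..1}" "1/2 \<in> I" "I \<inter> {0, 1} = {b}"
  using assms that[of 0] that[of 1]
  by (auto simp: half_domains_def closed_segment_eq_real_ivl)

lemma param_mem: "e \<in> edges C \<Longrightarrow> t \<in> {0..1} \<Longrightarrow> P e t \<in> e"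
  using is_arc_paramD(3)[OF param] by blast

lemma param_inj:
  "e \<in> edges C \<Longrightarrow> s \<in> {0..1} \<Longrightarrow> t \<in> {0..1} \<Longrightarrow> P e s = P e t \<longleftrightarrow> s = t"
  using is_arc_paramD(2)[OF param] by (auto simp: inj_on_def)

lemma param_vertex_iff:
  assumes "e \<in> edges C" "t \<in> {0..1}"
  shows "P e t \<in> verts C \<longleftrightarrow> t \<in> {0, 1}"
proof -
  have "P e t \<in> verts C \<longleftrightarrow> P e t \<in> {P e 0, P e 1}"
    using param_ends[OF assms(1)] param_mem[OF assms] by blast
  also have "\<dots> \<longleftrightarrow> t \<in> {0, 1}" using param_inj[OF assms(1)] assms(2) by auto
  finally show ?thesis .
qed

lemma edges_meet_in_vertices:
  "e \<in> edges C \<Longrightarrow> f \<in> edges C \<Longrightarrow> e \<noteq> f \<Longrightarrow> x \<in> e \<Longrightarrow> x \<in> f \<Longrightarrow> x \<in> verts C"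
  using ceg_edges_meet_in_vertices[OF ceg] by blast

lemma midpoint_not_vertex: "e \<in> edges C \<Longrightarrow> P e (1/2) \<notin> verts C"
  using param_vertex_iff[of e "1/2"] by simp

lemma midpoint_mem_iff:
  assumes "e \<in> edges C" "f \<in> edges C"
  shows "P f (1/2) \<in> e \<longleftrightarrow> e = f"
  using edges_meet_in_vertices[of e f "P f (1/2)"] midpoint_not_vertex[of f] param_mem[of f "1/2"]
    assms by auto

lemma half_subset: "e \<in> edges C \<Longrightarrow> I \<in> half_domains \<Longrightarrow> P e ` I \<subseteq> e"
  using param_mem by (meson half_domain_cases image_subsetI subsetD)

text \<open>A half keeps exactly one end of its edge, which is what makes the stars of the original vertices
  disjoint; its other end is the new midpoint.\<close>

lemma half_ends:
  assumes e: "e \<in> edges C" and I: "I \<in> half_domains"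
  obtains b where "b \<in> {0, 1}" "I = closed_segment b (1/2)"
    "P e ` I \<inter> verts C = {P e b}" "P e ` I \<inter> verts halved = {P e b, P e (1/2)}"
proof -
  obtain b where b: "b \<in> {0, 1}" "I = closed_segment b (1/2)" "I \<subseteq> {0..1}" "1/2 \<in> I" "I \<inter> {0, 1} = {b}"
    using half_domain_cases[OF I] by blast
  have V: "P e ` I \<inter> verts C = {P e b}"
  proof -
    have "P e ` I \<inter> verts C = P e ` (I \<inter> {0, 1})"
      using param_vertex_iff[OF e] b(3) by fast
    then show ?thesis using b(5) by simp
  qed
  have "P e ` I \<inter> (\<lambda>f. P f (1/2)) ` edges C = {P e (1/2)}"
    using half_subset[OF e I] midpoint_mem_iff[OF e] e b(4) by fastforce
  with V have "P e ` I \<inter> verts halved = {P e b, P e (1/2)}"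
    by (auto simp: halved_sel Int_Un_distrib)
  with that b V show thesis by blast
qed

lemma Union_edges_halved: "\<Union>(edges halved) = \<Union>(edges C)"
proof -
  have "{0..1/2} \<union> {1/2..1} = {0..1::real}" by auto
  then have "P e ` {0..1/2} \<union> P e ` {1/2..1} = e" if "e \<in> edges C" for e
    using is_arc_paramD(3)[OF param[OF that]] by (metis image_Un)
  moreover have "\<Union>(edges halved) = (\<Union>e\<in>edges C. P e ` {0..1/2} \<union> P e ` {1/2..1})"
    by (auto simp: halved_sel half_domains_def)
  ultimately show ?thesis by auto
qed

lemma verts_halved_subset: "verts halved - verts C \<subseteq> \<Union>(edges C)"
  using param_mem[of _ "1/2"] by (auto simp: halved_sel)

lemma ceg_halved: "ceg halved"
  unfolding ceg_def
proof (intro conjI)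
  show "closed_oriented_surface (surface halved) (atlas halved)"
    using ceg by (simp add: ceg_def halved_sel)
  show "finite (verts halved)" "finite (edges halved)"
    using ceg by (simp_all add: ceg_def halved_sel half_domains_def)
  have eX: "e \<subseteq> topspace (surface C)" if "e \<in> edges C" for e
    using is_arc_paramD(4)[OF param[OF that]] .
  then show "verts halved \<subseteq> topspace (surface halved)"
    using ceg param_mem[of _ "1/2"] by (fastforce simp: ceg_def halved_sel)
  show "\<forall>h\<in>edges halved. \<exists>g. is_arc_param (surface halved) h g \<and> h \<inter> verts halved = {g 0, g 1}"
  proof
    fix h assume "h \<in> edges halved"
    then obtain e I where e: "e \<in> edges C" and I: "I \<in> half_domains" and h: "h = P e ` I"
      by (rule halved_edge_cases)
    from half_ends[OF e I] obtain b where b: "b \<in> {0, 1}" "I = closed_segment b (1/2)"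
      "P e ` I \<inter> verts C = {P e b}" "P e ` I \<inter> verts halved = {P e b, P e (1/2)}" .
    let ?g = "\<lambda>t. P e ((1 - t) * b + t * (1/2))"
    have "is_arc_param (surface C) h ?g"
      unfolding h b(2) using b(1) by (intro is_arc_param_subarc[OF Hausdorff param[OF e]]) auto
    then have "is_arc_param (surface halved) h ?g" by (simp only: halved_sel)
    moreover have "h \<inter> verts halved = {?g 0, ?g 1}"
      unfolding h b(4) by simp
    ultimately show "\<exists>g. is_arc_param (surface halved) h g \<and> h \<inter> verts halved = {g 0, g 1}"
      by (intro exI[of _ ?g] conjI)
  qed
  show "\<forall>h\<in>edges halved. \<forall>k\<in>edges halved. h \<noteq> k \<longrightarrow> h \<inter> k \<subseteq> verts halved"
  proof (intro ballI impI subsetI)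
    fix h k x assume hk: "h \<in> edges halved" "k \<in> edges halved" "h \<noteq> k" and x: "x \<in> h \<inter> k"
    obtain e I where e: "e \<in> edges C" "I \<in> half_domains" "h = P e ` I"
      using halved_edge_cases[OF hk(1)] .
    obtain f J where f: "f \<in> edges C" "J \<in> half_domains" "k = P f ` J"
      using halved_edge_cases[OF hk(2)] .
    show "x \<in> verts halved"
    proof (cases "e = f")
      case True
      then have "I \<noteq> J" using e(3) f(3) hk(3) by auto
      then have IJ: "I \<inter> J = {1/2}" using e(2) f(2) by (auto simp: half_domains_def)
      obtain s t where "s \<in> I" "t \<in> J" "x = P e s" "x = P e t"
        using x e(3) f(3) True by auto
      moreover from this have "s \<in> {0..1}" "t \<in> {0..1}"
        using e(2) f(2) by (auto simp: half_domains_def)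
      ultimately have "s = t" using param_inj[OF e(1)] by blast
      with \<open>s \<in> I\<close> \<open>t \<in> J\<close> IJ have "s = 1/2" by blast
      with \<open>x = P e s\<close> have "x = P e (1/2)" by simp
      then show ?thesis using e(1) by (simp add: halved_sel)
    next
      case False
      have "x \<in> e" "x \<in> f" using half_subset e f x by blast+
      then show ?thesis using edges_meet_in_vertices e(1) f(1) False by (simp add: halved_sel)
    qed
  qed
  \<comment> \<open>The complement of the graph, and with it the set of faces, has not changed.\<close>
  have "verts halved \<union> \<Union>(edges halved) = verts C \<union> \<Union>(edges C)"
    using verts_halved_subset Union_edges_halved by (auto simp: halved_sel(3))
  then show "\<forall>D\<in>connected_components_of (subtopology (surface halved)
        (topspace (surface halved) - (verts halved \<union> \<Union>(edges halved)))).
        subtopology (surface halved) D homeomorphic_space top_of_set (ball (0::complex) 1)"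
    using ceg by (simp add: ceg_def halved_sel(1))
qed

lemma subdivision_of_halved: "subdivision_of halved C"
  unfolding subdivision_of_def
  using ceg_halved verts_halved_subset Union_edges_halved by (auto simp: halved_sel)

lemma edges_at_midpoint:
  assumes "e \<in> edges C"
  shows "card {h \<in> edges halved. P e (1/2) \<in> h} = 2"
proof -
  have "P e (1/2) \<in> P f ` I \<longleftrightarrow> f = e" if "f \<in> edges C" "I \<in> half_domains" for f I
    using that midpoint_mem_iff[OF that(1) assms] half_subset[OF that] half_domain_cases[OF that(2)]
    by (metis image_eqI subsetD)
  then have "{h \<in> edges halved. P e (1/2) \<in> h} = {P e ` {0..1/2}, P e ` {1/2..1}}"
    using assms by (auto simp: halved_sel half_domains_def)
  moreover have "P e ` {0..1/2} \<noteq> P e ` {1/2..1}"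
  proof
    assume "P e ` {0..1/2} = P e ` {1/2..1}"
    then have "P e 0 \<in> P e ` {1/2..1}" by auto
    then obtain t where "t \<in> {1/2..1}" "P e 0 = P e t" by auto
    then show False using param_inj[OF assms, of 0 t] by auto
  qed
  ultimately show ?thesis by simp
qed

text \<open>At the original vertices the orders can be prescribed independently, because every half belongs to
  exactly one of them, and at the midpoints there is nothing to prescribe.\<close>

lemma closure_of_epeg_halved: "closure_of_epeg halved"
proof -
  have "\<forall>v\<in>verts C. \<exists>es. ccw_order halved v es"
    using ceg_has_ccw_order[OF ceg_halved] by (simp add: halved_sel)
  then obtain ls where ls: "\<And>v. v \<in> verts C \<Longrightarrow> ccw_order halved v (ls v)"
    by metis
  then have set_ls: "set (ls v) = {h \<in> edges halved. v \<in> h}" and distinct_ls: "distinct (ls v)"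
    if "v \<in> verts C" for v
    using that by (auto simp: ccw_order_def)
  have one_end: "\<exists>v. h \<inter> verts C = {v}" if "h \<in> edges halved" for h
    using that by (auto simp: halved_sel elim: half_ends)
  have disjoint_ls: "set (ls v) \<inter> set (ls w) = {}" if vw: "v \<in> verts C" "w \<in> verts C" "v \<noteq> w" for v w
  proof -
    have "v = w" if h: "h \<in> edges halved" "v \<in> h" "w \<in> h" for h
    proof -
      obtain u where u: "h \<inter> verts C = {u}" using one_end[OF h(1)] ..
      have "v \<in> h \<inter> verts C" "w \<in> h \<inter> verts C" using h(2,3) vw(1,2) by simp_all
      then show ?thesis unfolding u by simp
    qed
    then show ?thesis using set_ls[OF vw(1)] set_ls[OF vw(2)] vw(3) by auto
  qed
  have "finite (verts C)" using ceg by (simp add: ceg_def)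
  then have "\<exists>L. distinct L \<and> set L = (\<Union>v\<in>verts C. set (ls v)) \<and>
      (\<forall>v\<in>verts C. filter (\<lambda>h. h \<in> set (ls v)) L = ls v)"
    using distinct_ls disjoint_ls by (rule ex_list_filter_eq_of_disjoint)
  then obtain L where L: "distinct L" "set L = (\<Union>v\<in>verts C. set (ls v))"
    and filter_L: "\<forall>v\<in>verts C. filter (\<lambda>h. h \<in> set (ls v)) L = ls v"
    by (elim exE conjE)
  have set_L: "set L = edges halved"
  proof
    show "set L \<subseteq> edges halved" unfolding L(2) using set_ls by auto
    show "edges halved \<subseteq> set L"
    proof
      fix h assume h: "h \<in> edges halved"
      obtain u where "h \<inter> verts C = {u}" using one_end[OF h] ..
      then have "u \<in> verts C" "u \<in> h" by auto
      then show "h \<in> set L" unfolding L(2) using set_ls[of u] h by auto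
    qed
  qed
  show ?thesis
  proof (rule closure_of_epeg_if_listed[OF ceg_halved L(1) set_L])
    fix v assume v: "v \<in> verts halved"
    show "ccw_order halved v (filter (\<lambda>h. v \<in> h) L)"
    proof (cases "v \<in> verts C")
      case True
      then have "filter (\<lambda>h. v \<in> h) L = filter (\<lambda>h. h \<in> set (ls v)) L"
        using set_ls set_L by (intro filter_cong) auto
      then show ?thesis using filter_L ls True by simp
    next
      case False
      then obtain e where e: "e \<in> edges C" "v = P e (1/2)" using v by (auto simp: halved_sel)
      obtain es where es: "ccw_order halved v es"
        using ceg_has_ccw_order[OF ceg_halved v] ..
      then have set_es: "set es = {h \<in> edges halved. v \<in> h}" "distinct es"
        by (auto simp: ccw_order_def)
      then have "length es = 2"
        using edges_at_midpoint[OF e(1)] e(2) distinct_card by metis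
      then show ?thesis
        using es set_es L(1) set_L by (intro ccw_order_two_edges[OF es]) auto
    qed
  qed
qed

end

theorem proposition4p19:
  fixes C :: "'a embedded_graph"
  assumes "ceg C"
  shows "\<exists>C'. subdivision_of C' C \<and> closure_of_epeg C'"
proof -
  have "\<exists>g. is_arc_param (surface C) e g \<and> e \<inter> verts C = {g 0, g 1}" if "e \<in> edges C" for e
    using ceg_edge_param[OF assms that] by blast
  then obtain P where "\<And>e. e \<in> edges C \<Longrightarrow> is_arc_param (surface C) e (P e)"
    and "\<And>e. e \<in> edges C \<Longrightarrow> e \<inter> verts C = {P e 0, P e 1}"
    by metis
  then interpret parametrized_ceg C P
    using assms by unfold_locales
  show ?thesis using subdivision_of_halved closure_of_epeg_halved by blast
qed

end
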